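(* Consider the time-expanded transportation graph $\mathcal G=(\mathcal V,\mathcal E)$ with link costs $\bar t_e$, link capacities $\bar x_e$, origins $I$, destinations $J$, demands $d_{ij}$, path sets $P_{ij}$, $P=\bigcup_{i\in I,j\in J}P_{ij}$, path costs $T_p$ and available path sets $P^{\mathrm{avail}}_{ij}(x)$ as defined in the context. Let $X$ be the set of all path flow vectors $x=(x_p)_{p\in P}\in\mathbb R^P$ satisfying $$x_p\ge 0\ \ \forall p\in P,\qquad \sum_{p\in P,\,p\ni e}x_p\le \bar x_e\ \ \forall e\in\mathcal E,\qquad \sum_{p\in P_{ij}}x_p=d_{ij}\ \ \forall i\in I,\ j\in J,$$ and assume that $X$ is nonempty. Then the equilibrium time and route choice problem has a solution, i.e. there exists $x\in X$ such that $$(T_{p'}-T_p)\,x_p\ge 0\qquad \forall i\in I,\ \forall j\in J,\ \forall p\in P_{ij},\ \forall p'\in P^{\mathrm{avail}}_{ij}(x),$$ and this solution $x$ is a solution (minimizer) of the linear programming problem $$\min_{x\in X}\ \sum_{p\in P}x_p\,T_p .$$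
   Context: Spatial network. $G=(V,E)$ is a finite simple directed graph whose links are partitioned as $E=E_R\cup E_J\cup E_C$ (road segments, junction links, centroid connectors). Links have free-flow times $\bar t_e$, measured in units of the time step (positive integers for $e\in E_R\cup E_J$), and capacities, which may be infinite (and are infinite on $E_R$). $V$ contains a set $I$ of origin centroids and a set of destination centroids, here denoted $J_0$. Time is discrete: $t\in\mathcal T=\{1,\dots,T\}$. Time-expanded graph $\mathcal G=(\mathcal V,\mathcal E)$ (a finite directed graph). - Nodes: the copies $(v,t)$, $t\in\mathcal T$, of every non-centroid node $v\in V\setminus(I\cup J_0)$; the origin centroids $i\in I$ (one copy each); a set $J$, a copy of $J_0\times\mathcal T$, whose node $(j,t)$ is the destination of users aiming to arrive at zone $j$ at time $t$; and a further disjoint copy $J'$ of $J_0\times\mathcal T$, whose node $(j,t')$ represents actual arrival at zone $j$ at time $t'$. - Road links: $((v_1,t_1),(v_2,t_2))$ for $(v_1,v_2)\in E_R$, $t_1,t_2\in\mathcal T$, $t_2-t_1\ge\bar t_{(v_1,v_2)}$. - Junction links: $((v_1,t),(v_2,t+\bar t_{(v_1,v_2)}))$ for $(v_1,v_2)\in E_J$ with both times in $\mathcal T$. - The cost of each road or junction link $((v_1,t_1),(v_2,t_2))$ is $t_2-t_1$. - Each origin $i\in I$ is linked to every time copy of each node it was connected to in $G$. Each node $(j,t')\in J'$ is reached by links from the corresponding time copies of the non-centroid nodes connected to $j$ in $G$, and is linked to every copy $(j,t)\in J$ of the same centroid. The cost of the link from $(j,t')\in J'$ to $(j,t)\in J$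 is the cost of arriving at zone $j$ at time $t'$ for users who aimed to arrive at time $t$. Every link $e\in\mathcal E$ thus has a fixed real cost $\bar t_e$ (independent of the flows) and a given capacity $\bar x_e\in[0,+\infty]$. For each $i\in I$ and $j\in J$ a demand $d_{ij}\ge 0$ is given. Paths and flows. $P_{ij}$ is the (finite) set of all directed paths in $\mathcal G$ from $i\in I$ to $j\in J$, and $P=\bigcup_{i\in I,j\in J}P_{ij}$. $p\ni e$ means that path $p$ uses link $e$. $T_p=\sum_{e\in p}\bar t_e$ is the travel cost of path $p$. A path flow vector is $x=(x_p)_{p\in P}$. For a path flow vector $x$, $P^{\mathrm{avail}}_{ij}(x)$ is the set of paths $p\in P_{ij}$ such that, for some $\delta_p>0$, the flow $x_p$ can be increased by $\delta_p$ (all other path flows unchanged) without violating the capacity constraints $\sum_{q\in P,\,q\ni e}x_q\le\bar x_e$, $e\in\mathcal E$. *)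

theory Defs
  imports "HOL-Library.Extended_Real" "HOL-Library.FuncSet" "Graph_Theory.Pair_Digraph"
begin

section \<open>Spatial networks\<close>

record 'v spatial_network =
  graph :: "'v pair_pre_digraph"
  roads :: "'v rel"
  junctions :: "'v rel"
  connectors :: "'v rel"
  free_flow_time :: "'v \<times> 'v \<Rightarrow> real"
  capacity :: "'v \<times> 'v \<Rightarrow> ereal"
  origin_centroids :: "'v set"
  dest_centroids :: "'v set"

text \<open>
  A centroid may be both an origin and a destination. Only the free-flow times of road and
  junction links have to be positive integers (time is measured in time steps); those of centroid
  connectors are unrestricted.
\<close>

locale spatial_network =
  fixes N :: "'v spatial_network"
  assumes graph: "pair_digraph (graph N)"
    and links: "parcs (graph N) = roads N \<union> junctions N \<union> connectors N"
    and links_disjoint: "roads N \<inter> junctions N = {}" "roads N \<inter> connectors N = {}"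
      "junctions N \<inter> connectors N = {}"
    and times: "e \<in> roads N \<union> junctions N \<Longrightarrow> free_flow_time N e \<in> \<nat> \<and> 0 < free_flow_time N e"
    and capacity_nonneg: "e \<in> parcs (graph N) \<Longrightarrow> 0 \<le> capacity N e"
    and capacity_roads: "e \<in> roads N \<Longrightarrow> capacity N e = \<infinity>"
    and centroids: "origin_centroids N \<subseteq> pverts (graph N)" "dest_centroids N \<subseteq> pverts (graph N)"

definition non_centroids :: "'v spatial_network \<Rightarrow> 'v set" where
  "non_centroids N = pverts (graph N) - (origin_centroids N \<union> dest_centroids N)"


section \<open>The time-expanded graph\<close>

text \<open>
  \<open>Target j t\<close> is the destination of the users aiming to arrive at zone \<open>j\<close> at time \<open>t\<close>
  (the set \<open>J\<close>); \<open>Arrival j t\<close> is the actual arrival at zone \<open>j\<close> at time \<open>t\<close> (the set \<open>J'\<close>).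
\<close>

datatype 'v te_node = Copy 'v nat | Origin 'v | Arrival 'v nat | Target 'v nat

type_synonym 'v te_link = "'v te_node \<times> 'v te_node"

definition te_origins :: "'v spatial_network \<Rightarrow> 'v te_node set" where
  "te_origins N = Origin ` origin_centroids N"

definition te_dests :: "'v spatial_network \<Rightarrow> nat \<Rightarrow> 'v te_node set" where
  "te_dests N T = {Target j t | j t. j \<in> dest_centroids N \<and> t \<in> {1..T}}"

definition te_nodes :: "'v spatial_network \<Rightarrow> nat \<Rightarrow> 'v te_node set" where
  "te_nodes N T =
     {Copy v t | v t. v \<in> non_centroids N \<and> t \<in> {1..T}} \<union> te_origins N \<union> te_dests N T \<union>
     {Arrival j t | j t. j \<in> dest_centroids N \<and> t \<in> {1..T}}"

text \<open>
  Restricting the links to pairs of nodes confines all times to \<open>{1..T}\<close>, the copied spatial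
  nodes to non-centroids, and the origins and zones to the given centroids.
\<close>

definition te_links :: "'v spatial_network \<Rightarrow> nat \<Rightarrow> 'v te_link set" where
  "te_links N T =
     ({(Copy v1 t1, Copy v2 t2) | v1 t1 v2 t2. (v1, v2) \<in> roads N \<and>
         real t2 - real t1 \<ge> free_flow_time N (v1, v2)} \<union>
      {(Copy v1 t1, Copy v2 t2) | v1 t1 v2 t2. (v1, v2) \<in> junctions N \<and>
         real t2 = real t1 + free_flow_time N (v1, v2)} \<union>
      {(Origin i, Copy v t) | i v t. (i, v) \<in> parcs (graph N)} \<union>
      {(Copy v t, Arrival j t) | v j t. (v, j) \<in> parcs (graph N)} \<union>
      {(Arrival j t', Target j t) | j t' t. True})
     \<inter> te_nodes N T \<times> te_nodes N T"

definition te_graph :: "'v spatial_network \<Rightarrow> nat \<Rightarrow> 'v te_node pair_pre_digraph" where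
  "te_graph N T = \<lparr> pverts = te_nodes N T, parcs = te_links N T \<rparr>"

lemma pair_digraph_te_graph:
  assumes "spatial_network N"
  shows "pair_digraph (te_graph N T)"
proof -
  interpret spatial_network N by fact
  interpret G: pair_digraph "graph N" by (rule graph)
  have "te_nodes N T \<subseteq> (\<lambda>(v, t). Copy v t) ` (pverts (graph N) \<times> {1..T}) \<union>
      Origin ` pverts (graph N) \<union> (\<lambda>(v, t). Target v t) ` (pverts (graph N) \<times> {1..T}) \<union>
      (\<lambda>(v, t). Arrival v t) ` (pverts (graph N) \<times> {1..T})"
    using centroids by (auto simp: te_nodes_def te_origins_def te_dests_def non_centroids_def)
  then have fin: "finite (te_nodes N T)"
    by (rule finite_subset) (simp add: G.pair_finite_verts)
  then have "finite (te_links N T)"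
    by (auto simp: te_links_def)
  moreover have "fst e \<noteq> snd e" if "e \<in> te_links N T" for e
    using that links G.pair_no_loops by (fastforce simp: te_links_def)
  ultimately show ?thesis
    using fin by unfold_locales (auto simp: te_graph_def te_links_def)
qed

text \<open>
  Link costs: \<open>\<gamma> j t' t\<close> is the cost of arriving at zone \<open>j\<close> at time \<open>t'\<close> for users aiming at
  time \<open>t\<close>. The costs of the links leaving the origins or entering \<open>J'\<close> are arbitrary.
\<close>

definition is_te_cost ::
    "'v spatial_network \<Rightarrow> nat \<Rightarrow> ('v \<Rightarrow> nat \<Rightarrow> nat \<Rightarrow> real) \<Rightarrow> ('v te_link \<Rightarrow> real) \<Rightarrow> bool" where
  "is_te_cost N T \<gamma> c \<longleftrightarrow>
     (\<forall>v1 t1 v2 t2. (Copy v1 t1, Copy v2 t2) \<in> te_links N T \<longrightarrow>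
        c (Copy v1 t1, Copy v2 t2) = real t2 - real t1) \<and>
     (\<forall>j t' t. (Arrival j t', Target j t) \<in> te_links N T \<longrightarrow>
        c (Arrival j t', Target j t) = \<gamma> j t' t)"


section \<open>Paths and path flows\<close>

text \<open>A path is the list of its links.\<close>

definition od_paths ::
    "'v spatial_network \<Rightarrow> nat \<Rightarrow> 'v te_node \<Rightarrow> 'v te_node \<Rightarrow> 'v te_link list set" where
  "od_paths N T i j = {p. pre_digraph.apath (with_proj (te_graph N T)) i p j}"

definition all_paths :: "'v spatial_network \<Rightarrow> nat \<Rightarrow> 'v te_link list set" where
  "all_paths N T = (\<Union>i\<in>te_origins N. \<Union>j\<in>te_dests N T. od_paths N T i j)"

definition path_cost :: "('v te_link \<Rightarrow> real) \<Rightarrow> 'v te_link list \<Rightarrow> real" where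
  "path_cost c p = (\<Sum>e\<leftarrow>p. c e)"

definition within_capacity ::
    "'v spatial_network \<Rightarrow> nat \<Rightarrow> ('v te_link \<Rightarrow> ereal) \<Rightarrow> ('v te_link list \<Rightarrow> real) \<Rightarrow> bool" where
  "within_capacity N T xbar x \<longleftrightarrow>
     (\<forall>e\<in>te_links N T. ereal (\<Sum>p | p \<in> all_paths N T \<and> e \<in> set p. x p) \<le> xbar e)"

text \<open>Path flow vectors are indexed by \<open>all_paths\<close>, hence the extensional function space.\<close>

definition feasible_flows ::
    "'v spatial_network \<Rightarrow> nat \<Rightarrow> ('v te_link \<Rightarrow> ereal) \<Rightarrow> ('v te_node \<Rightarrow> 'v te_node \<Rightarrow> real)
      \<Rightarrow> ('v te_link list \<Rightarrow> real) set" where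
  "feasible_flows N T xbar d =
     {x \<in> all_paths N T \<rightarrow>\<^sub>E UNIV.
        (\<forall>p\<in>all_paths N T. 0 \<le> x p) \<and>
        within_capacity N T xbar x \<and>
        (\<forall>i\<in>te_origins N. \<forall>j\<in>te_dests N T. (\<Sum>p\<in>od_paths N T i j. x p) = d i j)}"

definition avail_paths ::
    "'v spatial_network \<Rightarrow> nat \<Rightarrow> ('v te_link \<Rightarrow> ereal) \<Rightarrow> ('v te_link list \<Rightarrow> real)
      \<Rightarrow> 'v te_node \<Rightarrow> 'v te_node \<Rightarrow> 'v te_link list set" where
  "avail_paths N T xbar x i j =
     {p \<in> od_paths N T i j. \<exists>\<delta>>0. within_capacity N T xbar (x(p := x p + \<delta>))}"

end

theory Submission
  imports Defs "HOL-Analysis.Function_Topology"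
begin

text \<open>
  The feasible set is closed and bounded in a finite-dimensional space, so the linear programme has
  a minimizer. A minimizer is an equilibrium: if a used path \<open>p\<close> had a cheaper available alternative
  \<open>p'\<close>, moving a little flow from \<open>p\<close> to \<open>p'\<close> would stay feasible and lower the total cost.
\<close>

lemma finite_od_paths:
  assumes "spatial_network N"
  shows "finite (od_paths N T i j)"
proof -
  interpret pair_digraph "te_graph N T"
    using assms by (rule pair_digraph_te_graph)
  show ?thesis
    unfolding od_paths_def by (rule apaths_finite)
qed

lemma finite_all_paths:
  assumes "spatial_network N"
  shows "finite (all_paths N T)"
proof -
  interpret pair_digraph "te_graph N T"
    using assms by (rule pair_digraph_te_graph)
  have "all_paths N T \<subseteq> (\<lambda>(u, p, v). p) ` {(u, p, v). apath u p v}"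
    by (force simp: all_paths_def od_paths_def)
  then show ?thesis
    using apaths_finite_triple finite_surj by blast
qed

lemma od_paths_subset_all_paths:
  assumes "i \<in> te_origins N" "j \<in> te_dests N T"
  shows "od_paths N T i j \<subseteq> all_paths N T"
  using assms by (auto simp: all_paths_def)

text \<open>A nonempty list of links determines its first and last node, whereas the empty list is a
  walk from any node to itself. Origins and destinations are built by different constructors, so
  \<open>p\<close> cannot be empty. This makes the demand sums of different pairs range over
  disjoint sets of paths.\<close>

lemma od_paths_endpoints_unique:
  assumes "spatial_network N"
    and "i \<in> te_origins N" "j \<in> te_dests N T"
    and "p \<in> od_paths N T i j" "p \<in> od_paths N T i' j'"
  shows "i' = i" "j' = j"
proof -
  interpret pair_digraph "te_graph N T"
    using assms(1) by (rule pair_digraph_te_graph)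
  have walks: "awalk i p j" "awalk i' p j'"
    using assms(4,5) by (auto simp: od_paths_def apath_def)
  have "i \<noteq> j"
    using assms(2,3) by (auto simp: te_origins_def te_dests_def)
  then show "i' = i" "j' = j"
    using awalk_ends[OF walks] by auto
qed

text \<open>The ambient type consists of functions on all link lists, an infinite product, so
  compactness comes from Tychonoff: the set is a box of compact factors cut by closed
  constraints.\<close>

lemma compact_feasible_flows:
  assumes "spatial_network N"
  shows "compact (feasible_flows N T xbar d)"
proof -
  define P where "P = all_paths N T"
  \<comment> \<open>The supremum provides a bound for each path without choosing its origin and
    destination. For a nonempty feasible set it is a genuine upper bound, since no path carries more
    than the demand of its pair.\<close>
  define b where "b p = (SUP x\<in>feasible_flows N T xbar d. x p)" for p
  \<comment> \<open>Extensional flows are pinned to \<open>undefined\<close> off \<open>P\<close>,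
    which gives compact singleton factors there.\<close>
  define K where "K p = (if p \<in> P then {0..b p} else {undefined})" for p
  have bounded: "x p \<le> d i j"
    if "x \<in> feasible_flows N T xbar d" "i \<in> te_origins N" "j \<in> te_dests N T"
      "p \<in> od_paths N T i j" for x i j p
  proof -
    have "x p \<le> (\<Sum>q\<in>od_paths N T i j. x q)"
      using that od_paths_subset_all_paths[OF that(2,3)]
      by (intro member_le_sum finite_od_paths[OF assms]) (auto simp: feasible_flows_def)
    also have "\<dots> = d i j"
      using that by (auto simp: feasible_flows_def)
    finally show ?thesis .
  qed
  have bdd: "bdd_above ((\<lambda>x. x p) ` feasible_flows N T xbar d)" if "p \<in> P" for p
  proof -
    obtain i j where ij: "i \<in> te_origins N" "j \<in> te_dests N T" "p \<in> od_paths N T i j"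
      using \<open>p \<in> P\<close> by (auto simp: P_def all_paths_def)
    show ?thesis
      using bounded[OF _ ij] by (rule bdd_aboveI2)
  qed
  have "feasible_flows N T xbar d =
      (\<Pi>\<^sub>E p\<in>UNIV. K p) \<inter>
      ((\<Inter>e\<in>te_links N T. {x. ereal (\<Sum>p | p \<in> P \<and> e \<in> set p. x p) \<le> xbar e}) \<inter>
       (\<Inter>i\<in>te_origins N. \<Inter>j\<in>te_dests N T. {x. (\<Sum>p\<in>od_paths N T i j. x p) = d i j}))"
    (is "?X = ?K \<inter> ?C")
  proof -
    have "x p \<in> K p" if "x \<in> ?X" for x p
    proof (cases "p \<in> P")
      case True
      then have "x p \<le> b p"
        unfolding b_def by (intro cSUP_upper[OF that] bdd)
      moreover have "0 \<le> x p"
        using that True by (simp add: feasible_flows_def P_def)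
      ultimately show ?thesis
        using True by (simp add: K_def)
    next
      case False
      then have "x p = undefined"
        using that by (auto simp: P_def feasible_flows_def PiE_iff extensional_def)
      then show ?thesis
        using False by (simp add: K_def)
    qed
    then have "?X \<subseteq> ?K"
      by (simp add: subset_eq PiE_UNIV_domain)
    moreover have "?X \<subseteq> ?C"
      by (auto simp: feasible_flows_def within_capacity_def P_def)
    \<comment> \<open>Only the lower ends of the intervals matter here: the upper bounds
      \<open>b p\<close> follow from the constraints in \<open>?C\<close>.\<close>
    moreover have "x \<in> ?X" if x: "x \<in> ?K" "x \<in> ?C" for x
    proof -
      have "0 \<le> x p" if "p \<in> P" for p
        using PiE_mem[OF x(1), of p] that by (simp add: K_def)
      moreover have "x p = undefined" if "p \<notin> P" for p
        using PiE_mem[OF x(1), of p] that by (simp add: K_def)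
      ultimately show ?thesis
        using x(2) by (simp add: feasible_flows_def within_capacity_def P_def PiE_iff extensional_def)
    qed
    ultimately show ?thesis
      by (intro subset_antisym Int_greatest) auto
  qed
  moreover have "compact ?K"
  proof -
    have "compactin (product_topology (\<lambda>p. euclidean) UNIV) ?K"
      by (auto simp: compactin_PiE K_def)
    then show ?thesis
      by (simp add: euclidean_product_topology)
  qed
  \<comment> \<open>Each constraint compares a sum of coordinate projections, hence a continuous
    function, with a constant.\<close>
  moreover have "closed ?C"
    by (intro closed_Int closed_INT ballI closed_Collect_le closed_Collect_eq
          continuous_intros continuous_on_product_coordinates)
  ultimately show ?thesis
    by (simp only: compact_Int_closed)
qed

text \<open>Weight 1 yields the change of a demand sum, and path costs as weights yield the change
  of the total cost.\<close>

lemma sum_shift: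
  fixes x :: "'a \<Rightarrow> real"
  assumes "finite A" "p \<noteq> p'"
  shows "(\<Sum>q\<in>A. (x(p := x p - \<epsilon>, p' := x p' + \<epsilon>)) q * w q) =
    (\<Sum>q\<in>A. x q * w q) + (if p' \<in> A then \<epsilon> * w p' else 0) - (if p \<in> A then \<epsilon> * w p else 0)"
proof -
  have "(\<Sum>q\<in>A. (x(p := x p - \<epsilon>, p' := x p' + \<epsilon>)) q * w q) =
    (\<Sum>q\<in>A. x q * w q + (if p' = q then \<epsilon> * w q else 0) - (if p = q then \<epsilon> * w q else 0))"
    using assms(2) by (intro sum.cong) (auto simp: algebra_simps)
  also have "\<dots> = (\<Sum>q\<in>A. x q * w q) + (if p' \<in> A then \<epsilon> * w p' else 0)
      - (if p \<in> A then \<epsilon> * w p else 0)"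
    using assms(1) by (simp add: sum.distrib sum_subtractf)
  finally show ?thesis .
qed

text \<open>Lowering the flow on \<open>p\<close> only relieves links and \<epsilon> \<le> \<delta>,
  so every link load is at most the one obtained by adding \<delta> on \<open>p'\<close> alone,
  which \<open>cap\<close> admits.\<close>

lemma shift_feasible:
  assumes N: "spatial_network N"
    and x: "x \<in> feasible_flows N T xbar d"
    and ij: "i \<in> te_origins N" "j \<in> te_dests N T"
    and p: "p \<in> od_paths N T i j" and p': "p' \<in> od_paths N T i j" and ne: "p \<noteq> p'"
    and cap: "within_capacity N T xbar (x(p' := x p' + \<delta>))"
    and \<epsilon>: "0 \<le> \<epsilon>" "\<epsilon> \<le> \<delta>" "\<epsilon> \<le> x p"
  shows "x(p := x p - \<epsilon>, p' := x p' + \<epsilon>) \<in> feasible_flows N T xbar d" (is "?y \<in> _")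
proof -
  have mem: "p \<in> all_paths N T" "p' \<in> all_paths N T"
    using p p' od_paths_subset_all_paths[OF ij] by auto
  have "ereal (\<Sum>q | q \<in> all_paths N T \<and> e \<in> set q. ?y q) \<le> xbar e" if "e \<in> te_links N T" for e
  proof -
    have "(\<Sum>q | q \<in> all_paths N T \<and> e \<in> set q. ?y q) \<le>
        (\<Sum>q | q \<in> all_paths N T \<and> e \<in> set q. (x(p' := x p' + \<delta>)) q)"
      using \<epsilon> by (intro sum_mono) auto
    also have "ereal \<dots> \<le> xbar e"
      using cap that by (auto simp: within_capacity_def)
    finally show ?thesis by simp
  qed
  then have "within_capacity N T xbar ?y"
    by (simp add: within_capacity_def)
  moreover have "(\<Sum>q\<in>od_paths N T k l. ?y q) = d k l"
    if kl: "k \<in> te_origins N" "l \<in> te_dests N T" for k l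
  proof -
    \<comment> \<open>Both paths serve the pair \<open>i\<close>, \<open>j\<close> and no other, so
      the two \<epsilon> terms either cancel or are both absent.\<close>
    have "p \<in> od_paths N T k l \<longleftrightarrow> p' \<in> od_paths N T k l"
      using od_paths_endpoints_unique[OF N ij p] od_paths_endpoints_unique[OF N ij p'] p p' by blast
    then have "(\<Sum>q\<in>od_paths N T k l. ?y q) = (\<Sum>q\<in>od_paths N T k l. x q)"
      using sum_shift[OF finite_od_paths[OF N] ne, where w = "\<lambda>_. 1"] by simp
    then show ?thesis
      using x kl by (simp add: feasible_flows_def)
  qed
  ultimately show ?thesis
    using x mem \<epsilon> by (auto simp: feasible_flows_def PiE_iff extensional_def)
qed

lemma minimizer_is_equilibrium:
  assumes N: "spatial_network N"
    and x: "x \<in> feasible_flows N T xbar d"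
    and min: "\<And>y. y \<in> feasible_flows N T xbar d \<Longrightarrow>
      (\<Sum>q\<in>all_paths N T. x q * w q) \<le> (\<Sum>q\<in>all_paths N T. y q * w q)"
    and ij: "i \<in> te_origins N" "j \<in> te_dests N T"
    and p: "p \<in> od_paths N T i j" and p': "p' \<in> avail_paths N T xbar x i j"
  shows "0 \<le> (w p' - w p) * x p"
proof (rule ccontr)
  assume "\<not> ?thesis"
  moreover have mem: "p \<in> all_paths N T" "p' \<in> all_paths N T"
    using p p' od_paths_subset_all_paths[OF ij] by (auto simp: avail_paths_def)
  moreover have "0 \<le> x p"
    using x mem by (simp add: feasible_flows_def)
  ultimately have less: "w p' < w p" and pos: "0 < x p"
    by (auto simp: not_le mult_less_0_iff)
  obtain \<delta> where \<delta>: "0 < \<delta>" "within_capacity N T xbar (x(p' := x p' + \<delta>))"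
    using p' by (auto simp: avail_paths_def)
  \<comment> \<open>The largest shift permitted both by the spare capacity known for
    \<open>p'\<close> and by the flow present on \<open>p\<close>.\<close>
  define \<epsilon> where "\<epsilon> = min \<delta> (x p)"
  have \<epsilon>: "0 < \<epsilon>" "\<epsilon> \<le> \<delta>" "\<epsilon> \<le> x p"
    using \<delta> pos by (auto simp: \<epsilon>_def)
  have ne: "p \<noteq> p'"
    using less by auto
  have "x(p := x p - \<epsilon>, p' := x p' + \<epsilon>) \<in> feasible_flows N T xbar d"
    using p' \<epsilon> by (intro shift_feasible[OF N x ij p _ ne \<delta>(2)]) (auto simp: avail_paths_def)
  \<comment> \<open>The shift changes the total cost by \<epsilon> * (w p' - w p), which minimality
    forbids to be negative.\<close>
  from min[OF this] have "\<epsilon> * w p \<le> \<epsilon> * w p'"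
    using sum_shift[OF finite_all_paths[OF N] ne, of x \<epsilon> w T] mem by simp
  then show False
    using less \<epsilon>(1) by simp
qed

theorem theorem1:
  fixes N :: "'v spatial_network" and T :: nat
    and \<gamma> :: "'v \<Rightarrow> nat \<Rightarrow> nat \<Rightarrow> real"
    and c :: "'v te_link \<Rightarrow> real"
    and xbar :: "'v te_link \<Rightarrow> ereal"
    and d :: "'v te_node \<Rightarrow> 'v te_node \<Rightarrow> real"
  assumes "spatial_network N"
    and "is_te_cost N T \<gamma> c"
    and "\<forall>e\<in>te_links N T. 0 \<le> xbar e"
    and "\<forall>i\<in>te_origins N. \<forall>j\<in>te_dests N T. 0 \<le> d i j"
    and "feasible_flows N T xbar d \<noteq> {}"
  shows "\<exists>x\<in>feasible_flows N T xbar d.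
    (\<forall>i\<in>te_origins N. \<forall>j\<in>te_dests N T.
       \<forall>p\<in>od_paths N T i j. \<forall>p'\<in>avail_paths N T xbar x i j.
         (path_cost c p' - path_cost c p) * x p \<ge> 0) \<and>
    is_arg_min (\<lambda>y. \<Sum>p\<in>all_paths N T. y p * path_cost c p)
      (\<lambda>y. y \<in> feasible_flows N T xbar d) x"
proof -
  let ?cost = "\<lambda>y. \<Sum>p\<in>all_paths N T. y p * path_cost c p"
  have "continuous_on UNIV ?cost"
    by (intro continuous_intros continuous_on_product_coordinates)
  then have "continuous_on (feasible_flows N T xbar d) ?cost"
    by (rule continuous_on_subset) simp
  then obtain x where x: "x \<in> feasible_flows N T xbar d"
    and min: "\<And>y. y \<in> feasible_flows N T xbar d \<Longrightarrow> ?cost x \<le> ?cost y"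
    using continuous_attains_inf[OF compact_feasible_flows[OF assms(1)] assms(5)] by blast
  show ?thesis
    using x min minimizer_is_equilibrium[OF assms(1) x min]
    by (intro bexI[OF _ x]) (auto simp: is_arg_min_linorder)
qed

end
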